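(* Let $G$ be a finite nilpotent group which is not a $p$-group (for any prime $p$). Then the difference graph $\mathcal{D}(G)$ is a bipartite graph if and only if $G\cong P_1\times P_2$, where, for distinct primes $p_1,p_2$, $P_i$ is the Sylow $p_i$-subgroup of $G$ ($i\in\{1,2\}$), and $\exp(P_i)=p_i$ for at least one $i\in\{1,2\}$.
   Context: Difference graph: for a finite group $G$, the power graph $\mathcal{P}(G)$ is the simple undirected graph with vertex set $G$ in which distinct $a,b$ are adjacent iff $a\in\langle b\rangle$ or $b\in\langle a\rangle$. The enhanced power graph $\mathcal{P}_E(G)$ is the simple undirected graph with vertex set $G$ in which distinct $a,b$ are adjacent iff $a,b\in\langle c\rangle$ for some $c\in G$. The difference graph $\mathcal{D}(G)$ is obtained from the graph $\mathcal{P}_E(G)-\mathcal{P}(G)$ (vertex set $G$; two vertices are adjacent iff they are adjacent in $\mathcal{P}_E(G)$ but not in $\mathcal{P}(G)$) by removing all isolated vertices. $\exp(P)$ denotes the exponent of a group $P$, i.e. the least common multiple of the orders of its elements. *)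

theory Defs
  imports
    "HOL-Algebra.Multiplicative_Group"
    "HOL-Algebra.Sylow"
    "Graph_Theory.Pair_Digraph"
begin

section \<open>Graphs\<close>

text \<open>Simple undirected graphs are finite symmetric loop-free pair digraphs
  (locale \<open>pair_graph\<close>); an undirected edge is represented by its two arcs.\<close>

text \<open>The edge difference \<open>H - K\<close> of two graphs on the same vertex set.\<close>

definition graph_diff :: "'a pair_pre_digraph \<Rightarrow> 'a pair_pre_digraph \<Rightarrow> 'a pair_pre_digraph" where
  "graph_diff H K = \<lparr> pverts = pverts H, parcs = parcs H - parcs K \<rparr>"

definition isolated_verts :: "'a pair_pre_digraph \<Rightarrow> 'a set" where
  "isolated_verts H = {v \<in> pverts H. \<forall>w \<in> pverts H. (v, w) \<notin> parcs H \<and> (w, v) \<notin> parcs H}"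

definition remove_isolated :: "'a pair_pre_digraph \<Rightarrow> 'a pair_pre_digraph" where
  "remove_isolated H = \<lparr> pverts = pverts H - isolated_verts H, parcs = parcs H \<rparr>"

definition bipartite :: "'a pair_pre_digraph \<Rightarrow> bool" where
  "bipartite H \<longleftrightarrow>
    (\<exists>U V. U \<union> V = pverts H \<and> U \<inter> V = {} \<and> parcs H \<subseteq> (U \<times> V) \<union> (V \<times> U))"


section \<open>Graphs of a group\<close>

definition power_graph :: "('a, 'm) monoid_scheme \<Rightarrow> 'a pair_pre_digraph" where
  "power_graph G =
    \<lparr> pverts = carrier G,
      parcs = {(a, b). a \<in> carrier G \<and> b \<in> carrier G \<and> a \<noteq> b \<and>
                 (a \<in> generate G {b} \<or> b \<in> generate G {a})} \<rparr>"

definition enhanced_power_graph :: "('a, 'm) monoid_scheme \<Rightarrow> 'a pair_pre_digraph" where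
  "enhanced_power_graph G =
    \<lparr> pverts = carrier G,
      parcs = {(a, b). a \<in> carrier G \<and> b \<in> carrier G \<and> a \<noteq> b \<and>
                 (\<exists>c \<in> carrier G. a \<in> generate G {c} \<and> b \<in> generate G {c})} \<rparr>"

definition difference_graph :: "('a, 'm) monoid_scheme \<Rightarrow> 'a pair_pre_digraph" where
  "difference_graph G = remove_isolated (graph_diff (enhanced_power_graph G) (power_graph G))"

lemma pair_graph_power_graph:
  assumes "finite (carrier G)"
  shows "pair_graph (power_graph G)"
proof
  show "finite (parcs (power_graph G))"
    by (rule finite_subset[of _ "carrier G \<times> carrier G"]) (auto simp: power_graph_def assms)
qed (auto simp: power_graph_def assms symmetric_def sym_def)

lemma pair_graph_enhanced_power_graph:
  assumes "finite (carrier G)"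
  shows "pair_graph (enhanced_power_graph G)"
proof
  show "finite (parcs (enhanced_power_graph G))"
    by (rule finite_subset[of _ "carrier G \<times> carrier G"])
      (auto simp: enhanced_power_graph_def assms)
qed (auto simp: enhanced_power_graph_def assms symmetric_def sym_def)

lemma pair_graph_difference_graph:
  assumes "finite (carrier G)"
  shows "pair_graph (difference_graph G)"
proof
  show "finite (parcs (difference_graph G))"
    by (rule finite_subset[of _ "carrier G \<times> carrier G"])
      (auto simp: difference_graph_def remove_isolated_def graph_diff_def
        enhanced_power_graph_def assms)
qed (auto simp: difference_graph_def remove_isolated_def isolated_verts_def graph_diff_def
      enhanced_power_graph_def power_graph_def assms symmetric_def sym_def)


section \<open>Group-theoretic notions\<close>

primrec lower_central_series :: "('a, 'm) monoid_scheme \<Rightarrow> nat \<Rightarrow> 'a set" where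
  "lower_central_series G 0 = carrier G"
| "lower_central_series G (Suc n) =
    generate G (\<Union>x \<in> lower_central_series G n. \<Union>y \<in> carrier G.
      {x \<otimes>\<^bsub>G\<^esub> y \<otimes>\<^bsub>G\<^esub> inv\<^bsub>G\<^esub> x \<otimes>\<^bsub>G\<^esub> inv\<^bsub>G\<^esub> y})"

definition nilpotent_group :: "('a, 'm) monoid_scheme \<Rightarrow> bool" where
  "nilpotent_group G \<longleftrightarrow> group G \<and> (\<exists>n. lower_central_series G n = {\<one>\<^bsub>G\<^esub>})"

text \<open>For finite groups only. The trivial group is a \<open>p\<close>-group for every prime \<open>p\<close>.\<close>

definition finite_p_group :: "nat \<Rightarrow> ('a, 'm) monoid_scheme \<Rightarrow> bool" where
  "finite_p_group p G \<longleftrightarrow> group G \<and> (\<exists>n. order G = p ^ n)"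

definition sylow_subgroup :: "nat \<Rightarrow> 'a set \<Rightarrow> ('a, 'm) monoid_scheme \<Rightarrow> bool" where
  "sylow_subgroup p P G \<longleftrightarrow> subgroup P G \<and> card P = p ^ multiplicity p (order G)"

definition group_exponent :: "('a, 'm) monoid_scheme \<Rightarrow> nat" where
  "group_exponent G = Lcm (group.ord G ` carrier G)"

end

theory Submission
  imports Defs
begin

text \<open>
  In a cyclic group \<open>a \<in> \<langle>b\<rangle>\<close> means that the order of \<open>a\<close> divides the order of \<open>b\<close>, so the edges of
  the difference graph join the elements of a common cyclic subgroup whose orders are incomparable
  under divisibility. Elements of coprime order of a nilpotent group commute and hence lie in a common
  cyclic subgroup. Three prime divisors of the group order therefore yield a triangle, as do elements
  \<open>a\<close>, \<open>b\<close> of orders \<open>p\<^sup>2\<close>, \<open>q\<^sup>2\<close>, through \<open>a\<^sup>p b\<^sup>q\<close> of order \<open>p q\<close>.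
  Conversely, if all element orders divide \<open>p q\<^sup>k\<close>, then of two incomparable orders exactly one is
  divisible by \<open>p\<close>, which gives the bipartition.
\<close>

section \<open>Commuting elements in nilpotent groups\<close>

lemma (in group) conj_pow:
  fixes n :: nat
  assumes "x \<in> carrier G" "y \<in> carrier G"
  shows "(x \<otimes> y \<otimes> inv x) [^] n = x \<otimes> y [^] n \<otimes> inv x"
proof (induction n)
  case 0
  then show ?case using assms by simp
next
  case (Suc n)
  have *: "inv x \<otimes> (x \<otimes> z) = z" if "z \<in> carrier G" for z
    using assms that by (simp flip: m_assoc)
  have "(x \<otimes> y \<otimes> inv x) [^] Suc n = x \<otimes> y [^] n \<otimes> inv x \<otimes> (x \<otimes> y \<otimes> inv x)"
    by (simp only: nat_pow_Suc Suc)
  then show ?case using assms by (simp add: m_assoc *)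
qed

text \<open>The product \<open>c \<otimes> y\<close> is the conjugate of \<open>y\<close> by
  \<open>x\<close>, so its \<open>n\<close>-th power is trivial. As \<open>c\<close> commutes with
  \<open>y\<close>, this power is also the product of the \<open>n\<close>-th powers of
  \<open>c\<close> and \<open>y\<close>, which leaves that of \<open>c\<close>.\<close>

lemma (in group) commutator_pow_eq_one:
  fixes n :: nat
  assumes x: "x \<in> carrier G" and y: "y \<in> carrier G" and yn: "y [^] n = \<one>"
    and c: "c = x \<otimes> y \<otimes> inv x \<otimes> inv y" and cy: "c \<otimes> y = y \<otimes> c"
  shows "c [^] n = \<one>"
proof -
  have cc: "c \<in> carrier G" using x y c by simp
  have "c \<otimes> y = x \<otimes> y \<otimes> inv x" unfolding c using x y by (simp add: m_assoc)
  then have "(c \<otimes> y) [^] n = \<one>" using x y yn by (simp add: conj_pow)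
  then show ?thesis using pow_mult_distrib[OF cy cc y] yn cc by simp
qed

text \<open>The order of \<open>c\<close> divides \<open>n\<close> because \<open>y\<close> has
  exponent \<open>n\<close>. The inverse of \<open>c\<close> is the commutator of \<open>y\<close>
  and \<open>x\<close>, so the same argument with the roles exchanged shows that it divides
  \<open>m\<close> as well.\<close>

lemma (in group) commutator_eq_one_of_coprime:
  fixes m n :: nat
  assumes x: "x \<in> carrier G" and y: "y \<in> carrier G"
    and xm: "x [^] m = \<one>" and yn: "y [^] n = \<one>" and cop: "coprime m n"
    and c: "c = x \<otimes> y \<otimes> inv x \<otimes> inv y"
    and cx: "c \<otimes> x = x \<otimes> c" and cy: "c \<otimes> y = y \<otimes> c"
  shows "c = \<one>"
proof -
  have cc: "c \<in> carrier G" using x y c by simp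
  have 1: "ord c dvd n" using commutator_pow_eq_one[OF x y yn c cy] cc pow_eq_id by simp
  have ic: "inv c = y \<otimes> x \<otimes> inv y \<otimes> inv x" using x y by (simp add: c inv_mult_group m_assoc)
  have "inv c \<otimes> x = x \<otimes> inv c"
    using cx cc x by (metis inv_closed inv_solve_left inv_solve_right m_assoc m_closed)
  then have "ord (inv c) dvd m"
    using commutator_pow_eq_one[OF y x xm ic] cc pow_eq_id[of "inv c" m] by simp
  then have "ord c dvd m" using cc by simp
  with 1 cop have "ord c = 1" by (metis coprime_common_divisor_nat nat_dvd_1_iff_1 coprime_def)
  then show ?thesis using ord_eq_1[OF cc] by simp
qed

text \<open>Conjugating a commutator by \<open>g\<close> gives the commutator of the conjugates, so
  normality of one term makes the generating set of the next one closed under conjugation. Normality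
  is what allows quotients by these terms below.\<close>

lemma (in group) lower_central_series_normal: "lower_central_series G i \<lhd> G"
proof (induction i)
  case 0
  show ?case by (auto intro!: normal_invI subgroup_self)
next
  case (Suc i)
  interpret N: normal "lower_central_series G i" G by (rule Suc)
  show ?case unfolding lower_central_series.simps
  proof (rule normal_generateI)
    show "(\<Union>x\<in>lower_central_series G i. \<Union>y\<in>carrier G. {x \<otimes> y \<otimes> inv x \<otimes> inv y}) \<subseteq> carrier G"
      using N.subset by (auto intro!: m_closed)
  next
    fix h g
    assume "h \<in> (\<Union>x\<in>lower_central_series G i. \<Union>y\<in>carrier G. {x \<otimes> y \<otimes> inv x \<otimes> inv y})"
      and g: "g \<in> carrier G"
    then obtain x y where x: "x \<in> lower_central_series G i" and y: "y \<in> carrier G"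
      and h: "h = x \<otimes> y \<otimes> inv x \<otimes> inv y" by auto
    have xc: "x \<in> carrier G" using x N.subset by auto
    have *: "inv g \<otimes> (g \<otimes> z) = z" if "z \<in> carrier G" for z
      using g that by (simp flip: m_assoc)
    have "g \<otimes> h \<otimes> inv g = (g \<otimes> x \<otimes> inv g) \<otimes> (g \<otimes> y \<otimes> inv g) \<otimes> inv (g \<otimes> x \<otimes> inv g)
      \<otimes> inv (g \<otimes> y \<otimes> inv g)"
      using g xc y by (simp add: h m_assoc inv_mult_group *)
    moreover have "g \<otimes> x \<otimes> inv g \<in> lower_central_series G i" using N.inv_op_closed2 x g by simp
    moreover have "g \<otimes> y \<otimes> inv g \<in> carrier G" using g y by simp
    ultimately show "g \<otimes> h \<otimes> inv g
      \<in> (\<Union>x\<in>lower_central_series G i. \<Union>y\<in>carrier G. {x \<otimes> y \<otimes> inv x \<otimes> inv y})"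
      by blast
  qed
qed

text \<open>If the commutator lies in the \<open>i\<close>-th term of the series, then it is central modulo the next term, so
  that \<open>commutator_eq_one_of_coprime\<close> applies in the quotient.\<close>

lemma (in group) commutator_in_lower_central_series_of_coprime:
  fixes m n :: nat
  assumes x: "x \<in> carrier G" and y: "y \<in> carrier G"
    and xm: "x [^] m = \<one>" and yn: "y [^] n = \<one>" and cop: "coprime m n"
  shows "x \<otimes> y \<otimes> inv x \<otimes> inv y \<in> lower_central_series G i"
proof (induction i)
  case 0
  then show ?case using x y by simp
next
  case (Suc i)
  define N where "N = lower_central_series G (Suc i)"
  interpret N: normal N G unfolding N_def by (rule lower_central_series_normal)
  interpret Q: group "G Mod N" by (rule N.factorgroup_is_group)
  interpret h: group_hom G "G Mod N" "\<lambda>a. N #> a"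
    by unfold_locales (rule N.r_coset_hom_Mod)
  let ?c = "x \<otimes> y \<otimes> inv x \<otimes> inv y"
  have c: "?c \<in> carrier G" using x y by simp
  have kernel: "N #> a = \<one>\<^bsub>G Mod N\<^esub> \<longleftrightarrow> a \<in> N" if "a \<in> carrier G" for a
    using that N.rcos_const coset_join1[OF _ that N.subgroup_axioms] by (auto simp: FactGroup_def)
  have central: "(N #> ?c) \<otimes>\<^bsub>G Mod N\<^esub> (N #> a) = (N #> a) \<otimes>\<^bsub>G Mod N\<^esub> (N #> ?c)"
    if a: "a \<in> carrier G" for a
  proof -
    have "?c \<otimes> a \<otimes> inv ?c \<otimes> inv a \<in> N"
      unfolding N_def lower_central_series.simps using Suc a by (intro generate.incl) blast
    then have "N #> (?c \<otimes> a \<otimes> inv ?c \<otimes> inv a) = \<one>\<^bsub>G Mod N\<^esub>" 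
      by (rule iffD2[OF kernel, rotated]) (intro m_closed inv_closed x y a)
    then have "(N #> ?c) \<otimes>\<^bsub>G Mod N\<^esub> (N #> a) \<otimes>\<^bsub>G Mod N\<^esub> inv\<^bsub>G Mod N\<^esub> (N #> ?c)
        \<otimes>\<^bsub>G Mod N\<^esub> inv\<^bsub>G Mod N\<^esub> (N #> a) = \<one>\<^bsub>G Mod N\<^esub>"
      using c a by (simp only: h.hom_mult h.hom_inv m_closed inv_closed)
    then show ?thesis
      using h.hom_closed[OF c] h.hom_closed[OF a]
      by (metis Q.inv_closed Q.inv_solve_right Q.l_one Q.m_closed)
  qed
  have "N #> ?c = \<one>\<^bsub>G Mod N\<^esub>"
  proof (rule Q.commutator_eq_one_of_coprime[where x = "N #> x" and y = "N #> y" and m = m and n = n])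
    show "(N #> x) [^]\<^bsub>G Mod N\<^esub> m = \<one>\<^bsub>G Mod N\<^esub>" using h.hom_nat_pow[OF x, of m] xm h.hom_one by metis
    show "(N #> y) [^]\<^bsub>G Mod N\<^esub> n = \<one>\<^bsub>G Mod N\<^esub>" using h.hom_nat_pow[OF y, of n] yn h.hom_one by metis
    show "N #> ?c = (N #> x) \<otimes>\<^bsub>G Mod N\<^esub> (N #> y) \<otimes>\<^bsub>G Mod N\<^esub> inv\<^bsub>G Mod N\<^esub> (N #> x)
        \<otimes>\<^bsub>G Mod N\<^esub> inv\<^bsub>G Mod N\<^esub> (N #> y)"
      using x y by (simp only: h.hom_mult h.hom_inv m_closed inv_closed)
  qed (use x y cop central in \<open>auto intro: h.hom_closed\<close>)
  then show ?case using kernel[OF c] unfolding N_def by blast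
qed

text \<open>The commutator of \<open>x\<close> and \<open>y\<close> lies in every term of the lower
  central series, in particular in the trivial one.\<close>

lemma (in group) nilpotent_coprime_commute:
  fixes m n :: nat
  assumes "nilpotent_group G"
    and x: "x \<in> carrier G" and y: "y \<in> carrier G"
    and "x [^] m = \<one>" "y [^] n = \<one>" "coprime m n"
  shows "x \<otimes> y = y \<otimes> x"
proof -
  obtain i where "lower_central_series G i = {\<one>}"
    using assms(1) by (auto simp: nilpotent_group_def)
  then have "x \<otimes> y \<otimes> inv x \<otimes> inv y = \<one>"
    using commutator_in_lower_central_series_of_coprime[OF assms(2-6), of i] by simp
  then show ?thesis using x y by (metis inv_closed inv_solve_right l_one m_closed)
qed


section \<open>Cyclic subgroups\<close>

lemma (in group) pow_in_generate:
  fixes k :: nat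
  assumes "a \<in> carrier G" "b \<in> generate G {a}"
  shows "b [^] k \<in> generate G {a}"
proof -
  interpret S: subgroup "generate G {a}" G using assms by (intro generate_is_subgroup) simp
  show ?thesis by (induction k) (use assms in auto)
qed

lemma (in group) generate_pow_eq_one:
  fixes n :: nat
  assumes "v \<in> carrier G" "u \<in> generate G {v}" "v [^] n = \<one>"
  shows "u [^] n = \<one>"
proof -
  obtain k :: int where "u = v [^] k" using assms generate_pow by auto
  then have "u [^] n = (v [^] n) [^] k"
    using assms(1) by (simp add: int_pow_pow mult.commute flip: int_pow_int)
  then show ?thesis using assms by simp
qed

text \<open>With \<open>n = ord c\<close>, \<open>b = c [^] j\<close> and
  \<open>g = gcd n j\<close>, the element \<open>b\<close> is killed by \<open>n div g\<close>,
  hence so is \<open>a\<close>. This forces \<open>g\<close> to divide the exponent of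
  \<open>a\<close>, and \<open>c [^] g\<close> is a power of \<open>b\<close>.\<close>

lemma (in group) mem_generate_of_ord_dvd:
  assumes fin: "finite (carrier G)" and c: "c \<in> carrier G"
    and a: "a \<in> generate G {c}" and b: "b \<in> generate G {c}" and dvd: "ord a dvd ord b"
  shows "a \<in> generate G {b}"
proof -
  obtain i j :: nat where i: "a = c [^] i" and j: "b = c [^] j"
    using a b generate_pow_on_finite_carrier[OF fin c] by auto
  define n where "n = ord c"
  have n: "n > 0" using ord_ge_1[OF fin c] by (simp add: n_def)
  define g where "g = gcd n j"
  have "b [^] (n div g) = c [^] (n * (j div g))"
    using c by (simp add: j nat_pow_pow g_def div_mult_swap dvd_div_mult mult.commute)
  also have "\<dots> = \<one>" using c by (simp add: n_def flip: nat_pow_pow)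
  finally have "ord b dvd n div g" using pow_eq_id c j by simp
  then have "a [^] (n div g) = \<one>" using dvd pow_eq_id[of a] c i dvd_trans by simp
  then have "n dvd i * (n div g)" using c by (simp add: i nat_pow_pow pow_eq_id n_def)
  then have "g * (n div g) dvd i * (n div g)" by (simp add: g_def)
  moreover have "n div g \<noteq> 0" using n by (simp add: g_def dvd_div_eq_0_iff)
  ultimately have "g dvd i" by (auto intro: dvd_mult_cancel simp: mult.commute)
  then obtain e where e: "i = g * e" by auto
  \<comment> \<open>Since \<open>c [^] n\<close> is trivial, the Bezout identity turns
    \<open>c [^] g\<close> into the \<open>v\<close>-th power of \<open>b\<close>.\<close>
  obtain u v :: int where uv: "u * int n + v * int j = int g"
    using bezout_int[of "int n" "int j"] by (auto simp: g_def)
  have "c [^] g = c [^] (int n * u + int j * v)"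
    using uv by (simp add: mult.commute flip: int_pow_int)
  also have "\<dots> = (c [^] n) [^] u \<otimes> (c [^] j) [^] v"
    using c by (simp add: int_pow_mult flip: int_pow_pow int_pow_int)
  also have "\<dots> = b [^] v" using c by (simp add: n_def j)
  finally have "a = (b [^] v) [^] e" using c by (metis i e nat_pow_pow)
  moreover have "b [^] v \<in> generate G {b}" using generate_pow[of b] c j by auto
  ultimately show ?thesis using pow_in_generate[of b] c j by simp
qed

text \<open>The Bezout identity provides an exponent \<open>n * v\<close> that is congruent to 1
  modulo \<open>m\<close>. It kills \<open>b\<close> and fixes \<open>a\<close>, so the
  corresponding power of \<open>a \<otimes> b\<close> is \<open>a\<close>.\<close>

lemma (in group) mem_generate_mult_of_coprime:
  fixes m n :: nat
  assumes a: "a \<in> carrier G" and b: "b \<in> carrier G" and comm: "a \<otimes> b = b \<otimes> a"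
    and am: "a [^] m = \<one>" and bn: "b [^] n = \<one>" and cop: "coprime m n"
  shows "a \<in> generate G {a \<otimes> b}"
proof -
  obtain u v :: int where uv: "u * int m + v * int n = 1"
    using bezout_int[of "int m" "int n"] cop by (auto simp: coprime_iff_gcd_eq_1)
  have "(a \<otimes> b) [^] (int n * v) = a [^] (int n * v) \<otimes> b [^] (int n * v)"
    using int_pow_mult_distrib[OF comm a b] .
  also have "b [^] (int n * v) = \<one>" using b bn by (simp add: int_pow_int flip: int_pow_pow)
  also have "a [^] (int n * v) = a [^] (int n * v) \<otimes> a [^] (int m * u)"
    using a am by (simp add: int_pow_int flip: int_pow_pow)
  also have "\<dots> = a [^] (1::int)" using a uv by (simp add: mult.commute add.commute flip: int_pow_mult)
  finally have "a = (a \<otimes> b) [^] (int n * v)" using a by (simp add: int_pow_1)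
  then show ?thesis using generate_pow[of "a \<otimes> b"] a b by auto
qed


section \<open>Edges and triangles of the difference graph\<close>

text \<open>Removing isolated vertices keeps every arc, and \<open>a \<notin> generate G {b}\<close>
  already forces \<open>a \<noteq> b\<close>.\<close>

lemma difference_graph_arc_iff:
  "(a, b) \<in> parcs (difference_graph G) \<longleftrightarrow>
    a \<in> carrier G \<and> b \<in> carrier G \<and> a \<notin> generate G {b} \<and> b \<notin> generate G {a} \<and>
    (\<exists>c \<in> carrier G. a \<in> generate G {c} \<and> b \<in> generate G {c})"
  by (auto simp: difference_graph_def remove_isolated_def graph_diff_def enhanced_power_graph_def
      power_graph_def intro: generate.incl)

lemma bipartite_no_triangle:
  assumes "bipartite H" "(a, b) \<in> parcs H" "(b, c) \<in> parcs H" "(a, c) \<in> parcs H"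
  shows False
  using assms unfolding bipartite_def by blast

text \<open>Colour an element by whether \<open>p\<close> divides its order. Orders of the same
  colour are comparable under divisibility, and then of two elements in a common cyclic subgroup one
  generates the other.\<close>

lemma (in group) difference_graph_bipartite:
  fixes p q k :: nat
  assumes fin: "finite (carrier G)" and p: "prime p" and q: "prime q" and pq: "p \<noteq> q"
    and ord: "\<And>g. g \<in> carrier G \<Longrightarrow> ord g dvd p * q ^ k"
  shows "bipartite (difference_graph G)"
proof -
  let ?D = "difference_graph G"
  have cop: "coprime p (q ^ k)" using p q pq by (simp add: primes_coprime)
  have cmp: "ord a dvd ord b \<or> ord b dvd ord a"
    if "a \<in> carrier G" "b \<in> carrier G" and iff: "p dvd ord a \<longleftrightarrow> p dvd ord b" for a b
  proof -
    \<comment> \<open>Divisors of a prime power form a chain. Both colours reduce to this: either a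
      single factor \<open>p\<close> is cancelled from both orders, or \<open>p\<close> divides
      neither.\<close>
    have chain: "d dvd e \<or> e dvd d" if dvd: "d dvd q ^ k" "e dvd q ^ k" for d e
    proof -
      obtain i where "d = q ^ i" using iffD1[OF divides_primepow_nat[OF q] dvd(1)] by auto
      moreover obtain j where "e = q ^ j" using iffD1[OF divides_primepow_nat[OF q] dvd(2)] by auto
      ultimately show ?thesis by (metis le_imp_power_dvd linear)
    qed
    show ?thesis
    proof (cases "p dvd ord a")
      case True
      then obtain d e where d: "ord a = p * d" and e: "ord b = p * e" using iff by (auto elim!: dvdE)
      have "d dvd q ^ k" "e dvd q ^ k"
        using ord[OF that(1)] ord[OF that(2)] p by (auto simp: d e prime_gt_0_nat)
      then show ?thesis using chain[of d e] by (auto simp: d e)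
    next
      case False
      have "ord a dvd q ^ k" "ord b dvd q ^ k"
        using ord[OF that(1)] ord[OF that(2)] False iff p
        by (auto simp: coprime_dvd_mult_right_iff prime_imp_coprime coprime_commute)
      then show ?thesis using chain by blast
    qed
  qed
  let ?U = "{g \<in> pverts ?D. p dvd ord g}"
  have "parcs ?D \<subseteq> ?U \<times> (pverts ?D - ?U) \<union> (pverts ?D - ?U) \<times> ?U"
  proof
    fix e assume e: "e \<in> parcs ?D"
    obtain a b where ab: "e = (a, b)" by (cases e)
    note arc = e[unfolded ab difference_graph_arc_iff]
    have "(p dvd ord a) \<noteq> (p dvd ord b)" using cmp arc mem_generate_of_ord_dvd[OF fin] by meson
    moreover interpret D: pair_graph ?D by (rule pair_graph_difference_graph[OF fin])
    have "a \<in> pverts ?D" "b \<in> pverts ?D" using e ab D.in_arcsD1 D.in_arcsD2 by auto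
    ultimately show "e \<in> ?U \<times> (pverts ?D - ?U) \<union> (pverts ?D - ?U) \<times> ?U" using ab by auto
  qed
  then show ?thesis unfolding bipartite_def by (intro exI[of _ ?U] exI[of _ "pverts ?D - ?U"]) auto
qed

text \<open>An exponent killing \<open>v\<close> kills the whole of \<open>generate G {v}\<close>,
  so an exponent that kills \<open>v\<close> but not \<open>u\<close> witnesses
  non-membership.\<close>

lemma (in group) not_mem_generate_of_ord:
  assumes "v \<in> carrier G" "u \<in> carrier G" "v [^] n = \<one>" "\<not> ord u dvd n"
  shows "u \<notin> generate G {v}"
  using assms generate_pow_eq_one[of v u n] pow_eq_id[of u n] by blast

text \<open>Both elements are powers of \<open>a \<otimes> b\<close>, while coprime orders other
  than 1 do not divide each other.\<close>

lemma (in group) commuting_coprime_adjacent: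
  assumes a: "a \<in> carrier G" and b: "b \<in> carrier G" and comm: "a \<otimes> b = b \<otimes> a"
    and cop: "coprime (ord a) (ord b)" and "ord a \<noteq> 1" "ord b \<noteq> 1"
  shows "(a, b) \<in> parcs (difference_graph G)"
proof -
  have "\<not> ord a dvd ord b" "\<not> ord b dvd ord a"
    using assms by (auto simp: coprime_absorb_left coprime_absorb_right coprime_commute)
  then have "a \<notin> generate G {b}" "b \<notin> generate G {a}"
    using not_mem_generate_of_ord a b pow_ord_eq_1 by blast+
  moreover have "a \<in> generate G {a \<otimes> b}" "b \<in> generate G {a \<otimes> b}"
    using mem_generate_mult_of_coprime[OF a b comm _ _ cop]
      mem_generate_mult_of_coprime[OF b a comm[symmetric], of "ord b" "ord a"] a b cop comm
    by (auto simp: coprime_commute)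
  ultimately show ?thesis using a b by (auto simp: difference_graph_arc_iff)
qed

text \<open>The elements \<open>a\<close>, \<open>b\<close> and \<open>c\<close>, with
  \<open>c\<close> the product of \<open>a [^] p\<close> and \<open>b [^] q\<close>, all lie in the
  cyclic subgroup generated by \<open>a \<otimes> b\<close> and none of them is a power of another,
  so they form a triangle.\<close>

lemma (in group) not_bipartite_of_square_orders:
  fixes p q :: nat
  assumes a: "a \<in> carrier G" and b: "b \<in> carrier G" and comm: "a \<otimes> b = b \<otimes> a"
    and p: "prime p" and q: "prime q" and pq: "p \<noteq> q" and oa: "ord a = p\<^sup>2" and ob: "ord b = q\<^sup>2"
  shows "\<not> bipartite (difference_graph G)"
proof
  assume bip: "bipartite (difference_graph G)"
  define c where "c = a [^] p \<otimes> b [^] q"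
  have comm': "a [^] p \<otimes> b [^] q = b [^] q \<otimes> a [^] p"
    using a b comm by (metis group_commutes_pow nat_pow_closed)
  have c: "c \<in> carrier G" using a b by (simp add: c_def)
  have cpow: "c [^] n = a [^] (p * n) \<otimes> b [^] (q * n)" for n :: nat
    unfolding c_def using pow_mult_distrib[OF comm'] a b by (simp add: nat_pow_pow)
  have cop: "coprime p q" using p q pq by (rule primes_coprime)
  have ap: "a [^] (p * p) = \<one>" and bq: "b [^] (q * q) = \<one>"
    using a b oa ob by (simp_all add: pow_eq_id power2_eq_square)
  \<comment> \<open>An exponent of \<open>c\<close>, rather than its exact order, keeps
    \<open>a\<close> and \<open>b\<close> out of \<open>generate G {c}\<close>: neither square
    divides \<open>p * q\<close>.\<close>
  have c1: "c [^] (p * q) = \<one>"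
  proof -
    have "a [^] (p * (p * q)) = (a [^] (p * p)) [^] q" using a by (simp add: nat_pow_pow mult.assoc)
    moreover have "b [^] (q * (p * q)) = (b [^] (q * q)) [^] p"
      using b by (simp add: nat_pow_pow mult_ac)
    ultimately show ?thesis using cpow[of "p * q"] ap bq by simp
  qed
  have nd1: "\<not> p\<^sup>2 dvd p * q" and nd2: "\<not> q\<^sup>2 dvd p * q"
    using p q pq primes_dvd_imp_eq
    by (auto simp: power2_eq_square prime_gt_0_nat)
  have "ord a \<noteq> 1" "ord b \<noteq> 1" using oa ob p q by auto
  then have ab: "(a, b) \<in> parcs (difference_graph G)"
    using commuting_coprime_adjacent[OF a b comm] cop oa ob by simp
  have gen: "a \<in> generate G {a \<otimes> b}" "b \<in> generate G {a \<otimes> b}"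
    using mem_generate_mult_of_coprime[OF a b comm, of "ord a" "ord b"]
      mem_generate_mult_of_coprime[OF b a comm[symmetric], of "ord b" "ord a"] a b cop comm
    by (auto simp: oa ob coprime_commute simp del: pow_ord_eq_1)
      (auto simp flip: oa ob)
  interpret S: subgroup "generate G {a \<otimes> b}" G using a b by (intro generate_is_subgroup) simp
  have cg: "c \<in> generate G {a \<otimes> b}"
    unfolding c_def using gen a b by (intro S.m_closed pow_in_generate) auto
  have "a \<notin> generate G {c}" "b \<notin> generate G {c}"
    using not_mem_generate_of_ord[OF c _ c1] a b oa ob nd1 nd2 by auto
  moreover have "c \<notin> generate G {a}"
  proof
    \<comment> \<open>Then the square of \<open>p\<close> would kill \<open>c\<close> as well as the
      \<open>a\<close>-part of \<open>c\<close>, hence also its \<open>b\<close>-part, and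
      \<open>q\<close> would divide a power of \<open>p\<close>.\<close>
    assume "c \<in> generate G {a}"
    then have "c [^] (p * p) = \<one>" using generate_pow_eq_one a ap by blast
    moreover have "a [^] (p * (p * p)) = \<one>" using a ap by (metis nat_pow_one nat_pow_pow mult.commute)
    ultimately have "b [^] (q * (p * p)) = \<one>" using cpow[of "p * p"] b by simp
    then have "q * q dvd q * (p * p)" using b ob by (simp add: pow_eq_id power2_eq_square)
    then show False using p q pq primes_dvd_imp_eq by (auto simp: prime_gt_0_nat prime_dvd_mult_iff)
  qed
  moreover have "c \<notin> generate G {b}"
  proof
    assume "c \<in> generate G {b}"
    then have "c [^] (q * q) = \<one>" using generate_pow_eq_one b bq by blast
    moreover have "b [^] (q * (q * q)) = \<one>" using b bq by (metis nat_pow_one nat_pow_pow mult.commute)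
    ultimately have "a [^] (p * (q * q)) = \<one>" using cpow[of "q * q"] a by simp
    then have "p * p dvd p * (q * q)" using a oa by (simp add: pow_eq_id power2_eq_square)
    then show False using p q pq primes_dvd_imp_eq by (auto simp: prime_gt_0_nat prime_dvd_mult_iff)
  qed
  ultimately have "(a, c) \<in> parcs (difference_graph G)" "(b, c) \<in> parcs (difference_graph G)"
    using a b c gen cg by (auto simp: difference_graph_arc_iff intro!: bexI[of _ "a \<otimes> b"])
  then show False using bipartite_no_triangle[OF bip ab] by blast
qed


section \<open>Sylow subgroups and exponents\<close>

lemma (in group) subgroup_pow_card:
  assumes "subgroup P G" "x \<in> P"
  shows "x [^] card P = \<one>"
proof -
  interpret P: group "G\<lparr>carrier := P\<rparr>" using assms subgroup_imp_group by blast
  show ?thesis using P.pow_order_eq_1[of x] assms(2) by (simp add: order_def flip: nat_pow_consistent)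
qed

lemma (in group) subgroup_ord:
  assumes "subgroup P G" "x \<in> P"
  shows "group.ord (G\<lparr>carrier := P\<rparr>) x = ord x"
proof -
  interpret P: group "G\<lparr>carrier := P\<rparr>" using assms subgroup_imp_group by blast
  have "x \<in> carrier G" using assms subgroup.subset by blast
  then show ?thesis
    using P.ord_unique[of x "ord x"] assms(2) by (simp add: pow_eq_id flip: nat_pow_consistent)
qed

lemma (in group) subgroup_pow_exponent:
  assumes "subgroup P G" "x \<in> P"
  shows "x [^] group_exponent (G\<lparr>carrier := P\<rparr>) = \<one>"
proof -
  have "group.ord (G\<lparr>carrier := P\<rparr>) x dvd group_exponent (G\<lparr>carrier := P\<rparr>)"
    unfolding group_exponent_def using assms(2) by (intro dvd_Lcm) auto
  moreover have "x \<in> carrier G" using assms subgroup.subset by blast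
  ultimately show ?thesis using assms by (simp add: subgroup_ord pow_eq_id)
qed

text \<open>This is Cauchy's theorem. In \<open>sylow_thm\<close> the cofactor \<open>m\<close> may
  still be divisible by \<open>p\<close>, so the exponent 1 yields a subgroup of order
  \<open>p\<close>, and any nontrivial element of it has order \<open>p\<close>.\<close>

lemma (in group) prime_order_element:
  fixes p :: nat
  assumes fin: "finite (carrier G)" and p: "prime p" and dvd: "p dvd order G"
  obtains x where "x \<in> carrier G" "ord x = p"
proof -
  obtain m where "order G = p ^ 1 * m" using dvd by auto
  then obtain H where H: "subgroup H G" "card H = p"
    using sylow_thm[OF p group_axioms _ fin, of 1 m] by auto
  have "\<one> \<in> H" using H subgroup.one_closed by blast
  moreover have "H \<noteq> {\<one>}" using H p by auto
  ultimately obtain x where x: "x \<in> H" "x \<noteq> \<one>" by blast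
  have xc: "x \<in> carrier G" using x H subgroup.subset by blast
  have "ord x dvd p" using subgroup_pow_card[OF H(1) x(1)] H(2) xc pow_eq_id by simp
  moreover have "ord x \<noteq> 1" using ord_eq_1[OF xc] x by simp
  ultimately show ?thesis using that[OF xc] p by (auto simp: prime_nat_iff)
qed

text \<open>If every order divided \<open>p\<close>, the exponent would be \<open>p\<close>, since
  \<open>n > 0\<close> makes \<open>P\<close> nontrivial. So some \<open>x\<close> has order
  \<open>p ^ k\<close> with \<open>k \<ge> 2\<close>, and its power with exponent
  \<open>p ^ (k - 2)\<close> has the required order.\<close>

lemma (in group) prime_square_order_element:
  fixes p :: nat
  assumes fin: "finite (carrier G)" and p: "prime p" and P: "subgroup P G" and card: "card P = p ^ n"
    and n: "n > 0" and exp: "group_exponent (G\<lparr>carrier := P\<rparr>) \<noteq> p"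
  obtains x where "x \<in> P" "ord x = p\<^sup>2"
proof -
  have sub: "P \<subseteq> carrier G" using P subgroup.subset by blast
  have pow: "\<exists>k. ord x = p ^ k" if "x \<in> P" for x
  proof -
    have "ord x dvd p ^ n" using subgroup_pow_card[OF P that] sub that by (auto simp: card pow_eq_id)
    then show ?thesis using divides_primepow_nat[OF p, of "ord x" n] by auto
  qed
  have "\<exists>x\<in>P. \<not> ord x dvd p"
  proof (rule ccontr)
    assume "\<not> ?thesis"
    then have all: "ord x dvd p" if "x \<in> P" for x using that by blast
    have "\<one> \<in> P" using P subgroup.one_closed by blast
    moreover have "P \<noteq> {\<one>}" using card one_less_power[OF prime_gt_1_nat[OF p] n] by auto
    ultimately obtain x where x: "x \<in> P" "x \<noteq> \<one>" by blast
    have "ord x \<noteq> 1" using x sub ord_eq_1 by blast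
    then have "ord x = p" using all[OF x(1)] p by (auto simp: prime_nat_iff)
    then have "p dvd group_exponent (G\<lparr>carrier := P\<rparr>)"
      using subgroup_pow_exponent[OF P x(1)] sub x pow_eq_id by blast
    moreover have "group_exponent (G\<lparr>carrier := P\<rparr>) dvd p"
      unfolding group_exponent_def using all by (auto intro!: Lcm_least simp: subgroup_ord[OF P])
    ultimately show False using exp by (simp add: dvd_antisym)
  qed
  then obtain x where x: "x \<in> P" "\<not> ord x dvd p" by blast
  obtain k where k: "ord x = p ^ k" using pow x by blast
  have "k \<ge> 2"
  proof (rule ccontr)
    assume "\<not> k \<ge> 2"
    then have "k = 0 \<or> k = 1" by auto
    then show False using x k by auto
  qed
  then have eq: "p ^ k = p ^ (k - 2) * p\<^sup>2" by (metis le_add_diff_inverse2 power_add)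
  have "ord (x [^] (p ^ (k - 2))) = p\<^sup>2"
    using x sub p by (subst ord_pow) (auto simp: k eq prime_gt_0_nat)
  moreover have "x [^] (p ^ (k - 2)) \<in> P"
  proof -
    interpret P: group "G\<lparr>carrier := P\<rparr>" using P subgroup_imp_group by blast
    show ?thesis using P.nat_pow_closed[of x] x by (simp flip: nat_pow_consistent)
  qed
  ultimately show ?thesis using that by blast
qed

section \<open>Direct products of two subgroups\<close>

text \<open>Multiplication from the direct product to \<open>G\<close> is a homomorphism because
  \<open>P\<close> and \<open>Q\<close> commute elementwise, and it is injective because coprime
  orders give a trivial intersection. Surjectivity follows by counting.\<close>

lemma (in group) iso_DirProd_of_commuting:
  assumes fin: "finite (carrier G)" and P: "subgroup P G" and Q: "subgroup Q G"
    and comm: "\<And>x y. x \<in> P \<Longrightarrow> y \<in> Q \<Longrightarrow> x \<otimes> y = y \<otimes> x"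
    and cop: "coprime (card P) (card Q)" and card: "order G = card P * card Q"
  shows "G \<cong> (G\<lparr>carrier := P\<rparr>) \<times>\<times> (G\<lparr>carrier := Q\<rparr>)"
proof -
  interpret P: subgroup P G by (rule P)
  interpret Q: subgroup Q G by (rule Q)
  let ?H = "(G\<lparr>carrier := P\<rparr>) \<times>\<times> (G\<lparr>carrier := Q\<rparr>)"
  let ?f = "\<lambda>(x, y). x \<otimes> y"
  interpret H: group ?H using P Q by (intro DirProd_group subgroup_imp_group)
  have hom: "?f \<in> hom ?H G"
  proof (rule homI)
    fix u v assume "u \<in> carrier ?H" "v \<in> carrier ?H"
    then obtain x y x' y' where uv: "u = (x, y)" "v = (x', y')"
      and m: "x \<in> P" "x' \<in> P" "y \<in> Q" "y' \<in> Q" by auto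
    have "x \<otimes> x' \<otimes> (y \<otimes> y') = x \<otimes> (x' \<otimes> y) \<otimes> y'" using m by (simp add: m_assoc)
    also have "x' \<otimes> y = y \<otimes> x'" using m(2,3) by (rule comm)
    also have "x \<otimes> (y \<otimes> x') \<otimes> y' = x \<otimes> y \<otimes> (x' \<otimes> y')" using m by (simp add: m_assoc)
    finally show "?f (u \<otimes>\<^bsub>?H\<^esub> v) = ?f u \<otimes> ?f v" by (simp add: uv)
  qed auto
  have triv: "z = \<one>" if "z \<in> P" "z \<in> Q" for z
  proof -
    have "ord z dvd card P" "ord z dvd card Q"
      using subgroup_pow_card[OF P] subgroup_pow_card[OF Q] that by (simp_all flip: pow_eq_id)
    then have "ord z = 1" using cop by (metis coprime_common_divisor_nat)
    then show ?thesis using ord_eq_1 that by auto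
  qed
  have inj: "inj_on ?f (carrier ?H)"
  proof (rule inj_onI)
    fix u v assume "u \<in> carrier ?H" "v \<in> carrier ?H" and eq: "?f u = ?f v"
    then obtain x y x' y' where uv: "u = (x, y)" "v = (x', y')"
      and m: "x \<in> P" "x' \<in> P" "y \<in> Q" "y' \<in> Q" by auto
    have e: "x \<otimes> y = x' \<otimes> y'" using eq uv by simp
    \<comment> \<open>Separating the two factors exhibits one element that lies in both
      \<open>P\<close> and \<open>Q\<close>.\<close>
    have "inv x' \<otimes> x = inv x' \<otimes> (x \<otimes> y) \<otimes> inv y" using m by (simp add: m_assoc)
    also have "\<dots> = y' \<otimes> inv y" unfolding e using m by (simp flip: m_assoc)
    finally have z: "inv x' \<otimes> x = y' \<otimes> inv y" .
    have "inv x' \<otimes> x \<in> P" "inv x' \<otimes> x \<in> Q" using m by (auto, simp add: z)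
    then have "inv x' \<otimes> x = \<one>" by (rule triv)
    then have "x = x'" using m by (metis P.mem_carrier inv_closed inv_equality inv_inv)
    then show "u = v" using e m uv by simp
  qed
  have "card (?f ` carrier ?H) = card (carrier G)"
    using card_image[OF inj] card by (simp add: order_def card_cartesian_product)
  then have "?f ` carrier ?H = carrier G"
    using hom fin by (intro card_subset_eq) (auto simp: hom_def)
  then have "?f \<in> iso ?H G" using hom inj by (simp add: iso_def bij_betw_def)
  then have "?H \<cong> G" by (auto simp: is_iso_def)
  then show ?thesis by (rule H.iso_sym)
qed

text \<open>The isomorphism is arbitrary and need not be given by multiplication in
  \<open>G\<close>. The exponent is therefore computed componentwise in the direct product and
  pulled back by injectivity.\<close>

lemma (in group) iso_DirProd_subgroups_pow:
  fixes m n :: nat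
  assumes P: "subgroup P G" and Q: "subgroup Q G"
    and iso: "G \<cong> (G\<lparr>carrier := P\<rparr>) \<times>\<times> (G\<lparr>carrier := Q\<rparr>)"
    and m: "\<And>x. x \<in> P \<Longrightarrow> x [^] m = \<one>" and n: "\<And>y. y \<in> Q \<Longrightarrow> y [^] n = \<one>"
    and g: "g \<in> carrier G"
  shows "g [^] (m * n) = \<one>"
proof -
  let ?H = "(G\<lparr>carrier := P\<rparr>) \<times>\<times> (G\<lparr>carrier := Q\<rparr>)"
  interpret H: group ?H using P Q by (intro DirProd_group subgroup_imp_group)
  obtain f where f: "f \<in> iso G ?H" using iso by (auto simp: is_iso_def)
  interpret f: group_hom G ?H f using f by unfold_locales (simp add: iso_def)
  obtain x y where xy: "f g = (x, y)" and x: "x \<in> P" and y: "y \<in> Q"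
    using f.hom_closed[OF g] by (cases "f g") auto
  have "(x, y) [^]\<^bsub>?H\<^esub> k = (x [^] k, y [^] k)" for k :: nat
    by (induction k) auto
  moreover have "x [^] (m * n) = \<one>" "y [^] (m * n) = \<one>"
  proof -
    have "x \<in> carrier G" "y \<in> carrier G" using x y P Q subgroup.subset by blast+
    then show "x [^] (m * n) = \<one>" "y [^] (m * n) = \<one>"
      using m[OF x] n[OF y] by (metis nat_pow_one nat_pow_pow mult.commute)+
  qed
  ultimately have "f (g [^] (m * n)) = f \<one>" using g by (simp add: f.hom_nat_pow xy)
  moreover have "inj_on f (carrier G)" using f by (simp add: iso_def bij_betw_def)
  ultimately show ?thesis using g by (blast dest: inj_onD)
qed

section \<open>Prime divisors of the group order and the equivalence\<close>

text \<open>Elements of three distinct prime orders commute pairwise by nilpotency, hence are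
  pairwise adjacent and form a triangle.\<close>

lemma (in group) nilpotent_bipartite_imp_at_most_two_primes:
  fixes p q r :: nat
  assumes fin: "finite (carrier G)" and nil: "nilpotent_group G"
    and bip: "bipartite (difference_graph G)"
    and p: "prime p" "p dvd order G" and q: "prime q" "q dvd order G" and r: "prime r" "r dvd order G"
  shows "p = q \<or> q = r \<or> p = r"
proof (rule ccontr)
  assume ne: "\<not> ?thesis"
  have arc: "(x, y) \<in> parcs (difference_graph G)"
    if "x \<in> carrier G" "y \<in> carrier G" "ord x = s" "ord y = t" "prime s" "prime t" "s \<noteq> t" for x y s t
  proof -
    have cop: "coprime (ord x) (ord y)" using that by (simp add: primes_coprime)
    have "x \<otimes> y = y \<otimes> x"
      using that(1,2) cop by (intro nilpotent_coprime_commute[OF nil, where m = "ord x" and n = "ord y"]) auto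
    then show ?thesis using commuting_coprime_adjacent that cop by (metis not_prime_1)
  qed
  obtain x where x: "x \<in> carrier G" "ord x = p" using prime_order_element[OF fin p] .
  obtain y where y: "y \<in> carrier G" "ord y = q" using prime_order_element[OF fin q] .
  obtain z where z: "z \<in> carrier G" "ord z = r" using prime_order_element[OF fin r] .
  show False
    using bipartite_no_triangle[OF bip arc[OF x(1) y(1) x(2) y(2)] arc[OF y(1) z(1) y(2) z(2)]
      arc[OF x(1) z(1) x(2) z(2)]] p q r ne by blast
qed

text \<open>After the full power of one prime divisor \<open>p\<close> is split off, the cofactor is
  not 1 and is prime to \<open>p\<close>, so any prime divisor of it is a second one.\<close>

lemma exists_two_prime_divisors:
  fixes n :: nat
  assumes "n > 0" and "\<not> (\<exists>p. prime p \<and> (\<exists>k. n = p ^ k))"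
  obtains p q where "prime p" "prime q" "p \<noteq> q" "p dvd n" "q dvd n"
proof -
  \<comment> \<open>The number 1 counts as a prime power with exponent 0.\<close>
  have "n \<noteq> 1" using assms(2) by (metis power_0 two_is_prime_nat)
  then obtain p where p: "prime p" "p dvd n" using prime_factor_nat by blast
  obtain k m where m: "n = p ^ k * m" "\<not> p dvd m"
    using multiplicity_decompose'[of n p] assms(1) p by (metis not_prime_unit neq0_conv)
  have "m \<noteq> 1" using assms(2) p m by (metis mult.right_neutral)
  then obtain q where q: "prime q" "q dvd m" using prime_factor_nat by blast
  then show ?thesis using that p m by (metis dvd_mult)
qed

theorem theorem4p5:
  fixes G :: "('a, 'm) monoid_scheme"
  assumes "group G"
    and "finite (carrier G)"
    and "nilpotent_group G"
    and "\<not> (\<exists>p. prime p \<and> finite_p_group p G)"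
  shows "bipartite (difference_graph G) \<longleftrightarrow>
    (\<exists>(p1::nat) (p2::nat) P1 P2.
      prime p1 \<and> prime p2 \<and> p1 \<noteq> p2 \<and>
      sylow_subgroup p1 P1 G \<and> sylow_subgroup p2 P2 G \<and>
      G \<cong> (G\<lparr>carrier := P1\<rparr>) \<times>\<times> (G\<lparr>carrier := P2\<rparr>) \<and>
      (group_exponent (G\<lparr>carrier := P1\<rparr>) = p1 \<or> group_exponent (G\<lparr>carrier := P2\<rparr>) = p2))"
    (is "?bip \<longleftrightarrow> ?struct")
proof
  interpret group G by fact
  note fin = assms(2)
  have pos: "order G > 0" using fin by (simp add: order_gt_0_iff_finite)
  assume bip: ?bip
  have "\<not> (\<exists>p. prime p \<and> (\<exists>k. order G = p ^ k))"
    using assms(4) group_axioms by (auto simp: finite_p_group_def)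
  then obtain p q where p: "prime p" "p dvd order G" and q: "prime q" "q dvd order G" and pq: "p \<noteq> q"
    using exists_two_prime_divisors[OF pos] by metis
  define m n where "m = multiplicity p (order G)" and "n = multiplicity q (order G)"
  \<comment> \<open>A third prime divisor would produce a triangle, so the order factors into the
    two Sylow orders.\<close>
  have "prime_factors (order G) = {p, q}"
    using nilpotent_bipartite_imp_at_most_two_primes[OF fin assms(3) bip p q] pq p q pos
    by (auto simp: prime_factors_dvd)
  then have ord: "order G = p ^ m * q ^ n"
    using prime_factorization_nat[of "order G"] pos pq by (simp add: m_def n_def)
  have mn: "m > 0" "n > 0"
    using p q pos by (auto simp: m_def n_def prime_multiplicity_gt_zero_iff)
  obtain P where P: "subgroup P G" "card P = p ^ m"
    using sylow_thm[OF p(1) group_axioms ord fin] by blast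
  obtain Q where Q: "subgroup Q G" "card Q = q ^ n"
    using sylow_thm[OF q(1) group_axioms _ fin] ord by (metis mult.commute)
  have cop: "coprime (card P) (card Q)" using p q pq by (simp add: P Q primes_coprime)
  have comm: "x \<otimes>\<^bsub>G\<^esub> y = y \<otimes>\<^bsub>G\<^esub> x" if "x \<in> P" "y \<in> Q" for x y
    using that P Q subgroup.subset subgroup_pow_card cop
    by (intro nilpotent_coprime_commute[OF assms(3), where m = "card P" and n = "card Q"]) blast+
  \<comment> \<open>If both exponents differed from their primes, \<open>P\<close> and
    \<open>Q\<close> would contain commuting elements of orders the squares of \<open>p\<close> and
    \<open>q\<close>, which again gives a triangle.\<close>
  have "group_exponent (G\<lparr>carrier := P\<rparr>) = p \<or> group_exponent (G\<lparr>carrier := Q\<rparr>) = q"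
  proof (rule ccontr)
    assume ne: "\<not> ?thesis"
    obtain a where a: "a \<in> P" "ord a = p\<^sup>2"
      using prime_square_order_element[OF fin p(1) P mn(1)] ne by blast
    obtain b where b: "b \<in> Q" "ord b = q\<^sup>2"
      using prime_square_order_element[OF fin q(1) Q mn(2)] ne by blast
    have "a \<in> carrier G" "b \<in> carrier G" using a b P Q subgroup.subset by blast+
    then show False
      using not_bipartite_of_square_orders[OF _ _ comm[OF a(1) b(1)] p(1) q(1) pq a(2) b(2)] bip by blast
  qed
  moreover have "G \<cong> (G\<lparr>carrier := P\<rparr>) \<times>\<times> (G\<lparr>carrier := Q\<rparr>)"
    using iso_DirProd_of_commuting[OF fin P(1) Q(1) comm cop] ord P Q by simp
  ultimately show ?struct
    using p q pq P Q unfolding sylow_subgroup_def m_def n_def by blast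
next
  interpret group G by fact
  assume ?struct
  then obtain p q :: nat and P Q where p: "prime p" and q: "prime q" and pq: "p \<noteq> q"
    and P: "sylow_subgroup p P G" and Q: "sylow_subgroup q Q G"
    and iso: "G \<cong> (G\<lparr>carrier := P\<rparr>) \<times>\<times> (G\<lparr>carrier := Q\<rparr>)"
    and exp: "group_exponent (G\<lparr>carrier := P\<rparr>) = p \<or> group_exponent (G\<lparr>carrier := Q\<rparr>) = q"
    by auto
  obtain m n where P': "subgroup P G" "card P = p ^ m" and Q': "subgroup Q G" "card Q = q ^ n"
    using P Q by (auto simp: sylow_subgroup_def)
  have pow: "x [^]\<^bsub>G\<^esub> (p ^ m) = \<one>\<^bsub>G\<^esub>" if "x \<in> P" for x using subgroup_pow_card[OF P'(1) that] P' by simp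
  have qow: "x [^]\<^bsub>G\<^esub> (q ^ n) = \<one>\<^bsub>G\<^esub>" if "x \<in> Q" for x using subgroup_pow_card[OF Q'(1) that] Q' by simp
  from exp show ?bip
  proof
    assume "group_exponent (G\<lparr>carrier := P\<rparr>) = p"
    then have "x [^]\<^bsub>G\<^esub> p = \<one>\<^bsub>G\<^esub>" if "x \<in> P" for x using subgroup_pow_exponent[OF P'(1) that] by simp
    \<comment> \<open>The factor of prime exponent contributes \<open>p\<close>, the other one at
      most its order \<open>q ^ n\<close>. This is the shape of orders for which divisibility by
      \<open>p\<close> is a proper 2-colouring.\<close>
    then have "ord g dvd p * q ^ n" if "g \<in> carrier G" for g
      using iso_DirProd_subgroups_pow[OF P'(1) Q'(1) iso _ qow that] that pow_eq_id by blast
    then show ?bip by (rule difference_graph_bipartite[OF assms(2) p q pq])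
  next
    assume "group_exponent (G\<lparr>carrier := Q\<rparr>) = q"
    then have "x [^]\<^bsub>G\<^esub> q = \<one>\<^bsub>G\<^esub>" if "x \<in> Q" for x using subgroup_pow_exponent[OF Q'(1) that] by simp
    then have "ord g dvd q * p ^ m" if "g \<in> carrier G" for g
      using iso_DirProd_subgroups_pow[OF P'(1) Q'(1) iso pow _ that] that pow_eq_id
      by (simp add: mult.commute)
    then show ?bip by (rule difference_graph_bipartite[OF assms(2) q p pq[symmetric]])
  qed
qed

end
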